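(* Let $n\ge 1$ be an integer, let $\zeta\in\mathbb{C}$ be a primitive $n$th root of unity, and let $p,q\in\mathbb{C}$. Fix a square root $\sqrt{q^2-4p^n}$ in $\mathbb{C}$, and let $a,b\in\mathbb{C}$ satisfy $$a^n=\frac{q+\sqrt{q^2-4p^n}}{2},\qquad b^n=\frac{q-\sqrt{q^2-4p^n}}{2},\qquad ab=p$$ (that is, $a,b=\sqrt[n]{\frac{q\pm\sqrt{q^2-4p^n}}{2}}$, with the choice of $n$th roots respecting $ab=p$). Then the roots, listed with multiplicity, of the polynomial $L_n(z,p)-q$ in $z$ are the numbers $\zeta^{j}a+\zeta^{-j}b$ for $j=0,1,\dots,n-1$.
   Context: For each integer $n\ge 0$, $L_n(X,Y)\in\mathbb{Z}[X,Y]$ denotes the unique polynomial with integer coefficients such that $L_n(s+t,st)=s^n+t^n$ holds as an identity in $\mathbb{Z}[s,t]$, where $s,t$ are indeterminates. (Existence and uniqueness are given by the fundamental theorem on symmetric polynomials in two indeterminates.) *)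

theory Defs
  imports "HOL-Computational_Algebra.Computational_Algebra" Complex_Main
begin

text \<open>
  We represent \<open>\<int>[X,Y]\<close> as \<^typ>\<open>int poly poly\<close>: the outer variable is \<open>X\<close>, the
  coefficients lie in \<open>\<int>[Y]\<close>. \<open>eval2 F x y\<close> is the value of \<open>F\<close> at \<open>X = x\<close>, \<open>Y = y\<close> in an
  arbitrary commutative ring.
\<close>

definition eval2 :: "int poly poly \<Rightarrow> 'a :: comm_ring_1 \<Rightarrow> 'a \<Rightarrow> 'a" where
  "eval2 F x y = poly (map_poly (\<lambda>c. poly (map_poly of_int c) y) F) x"

text \<open>The indeterminates of \<open>\<int>[s,t]\<close>.\<close>

definition indet_s :: "int poly poly" where "indet_s = [:0, 1:]"
definition indet_t :: "int poly poly" where "indet_t = [:[:0, 1:]:]"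

definition Lpoly :: "nat \<Rightarrow> int poly poly" where
  "Lpoly n = (THE F. eval2 F (indet_s + indet_t) (indet_s * indet_t) = indet_s ^ n + indet_t ^ n)"

definition primitive_root_of_unity :: "nat \<Rightarrow> complex \<Rightarrow> bool" where
  "primitive_root_of_unity n z \<longleftrightarrow> n \<ge> 1 \<and> z ^ n = 1 \<and> (\<forall>k. 0 < k \<and> k < n \<longrightarrow> z ^ k \<noteq> 1)"

text \<open>The description in \<open>Lpoly_def\<close> is proper: such a polynomial exists and is unique.\<close>

lemma eval2_0 [simp]: "eval2 0 x y = 0"
  by (simp add: eval2_def)

lemma eval2_pCons [simp]:
  "eval2 (pCons c F) x y = poly (map_poly of_int c) y + x * eval2 F x y"
  by (simp add: eval2_def map_poly_pCons)

lemma poly_of_int_add: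
  "poly (map_poly of_int (c + d)) (y :: 'a :: comm_ring_1) =
     poly (map_poly of_int c) y + poly (map_poly of_int d) y"
  by (induction c d rule: poly_induct2) (simp_all add: map_poly_pCons algebra_simps)

lemma poly_of_int_smult:
  "poly (map_poly of_int (smult k d)) (y :: 'a :: comm_ring_1) =
     of_int k * poly (map_poly of_int d) y"
  by (induction d) (simp_all add: map_poly_pCons algebra_simps)

lemma poly_of_int_mult:
  "poly (map_poly of_int (c * d)) (y :: 'a :: comm_ring_1) =
     poly (map_poly of_int c) y * poly (map_poly of_int d) y"
  by (induction c)
     (simp_all add: map_poly_pCons poly_of_int_add poly_of_int_smult algebra_simps)

lemma eval2_add: "eval2 (F + G) x y = eval2 F x y + eval2 G x y"
  by (induction F G rule: poly_induct2) (simp_all add: poly_of_int_add algebra_simps)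

lemma eval2_smult: "eval2 (smult c F) x y = poly (map_poly of_int c) y * eval2 F x y"
  by (induction F) (simp_all add: poly_of_int_mult algebra_simps)

lemma eval2_mult: "eval2 (F * G) x y = eval2 F x y * eval2 G x y"
  by (induction F) (simp_all add: eval2_add eval2_smult algebra_simps)

lemma eval2_minus: "eval2 (- F) x y = - eval2 F x y"
  using eval2_add [of F "- F" x y] by (simp add: add_eq_0_iff)

lemma eval2_diff: "eval2 (F - G) x y = eval2 F x y - eval2 G x y"
  using eval2_add [of F "- G" x y] by (simp add: eval2_minus)

lemma eval2_const: "eval2 [:[:k:]:] x y = of_int k"
  by (simp add: map_poly_pCons)

lemma eval2_indet_s [simp]: "eval2 indet_s x y = x"
  by (simp add: indet_s_def map_poly_pCons)

lemma eval2_indet_t [simp]: "eval2 indet_t x y = y"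
  by (simp add: indet_t_def map_poly_pCons)

lemma poly_of_int_eval2:
  "eval2 (poly (map_poly of_int c) v) x y = poly (map_poly of_int c) (eval2 v x y)"
  by (induction c)
     (simp_all add: map_poly_pCons eval2_add eval2_mult of_int_poly eval2_const)

lemma eval2_eval2: "eval2 (eval2 F u v) x y = eval2 F (eval2 u x y) (eval2 v x y)"
  by (induction F) (simp_all add: eval2_add eval2_mult poly_of_int_eval2)

lemma Lpoly_exists:
  "\<exists>F. eval2 F (indet_s + indet_t) (indet_s * indet_t) = indet_s ^ n + indet_t ^ n"
proof (induction n rule: less_induct)
  case (less n)
  consider "n = 0" | "n = 1" | m where "n = Suc (Suc m)"
    by (metis One_nat_def not0_implies_Suc)
  thus ?case
  proof cases
    case 1
    have "eval2 2 (indet_s + indet_t) (indet_s * indet_t) = 2"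
      using eval2_const [of 2 "indet_s + indet_t" "indet_s * indet_t"]
      by (simp add: numeral_poly)
    thus ?thesis using 1 by (intro exI [of _ 2]) simp
  next
    case 2
    thus ?thesis by (intro exI [of _ indet_s]) simp
  next
    case (3 m)
    obtain F G where
      F: "eval2 F (indet_s + indet_t) (indet_s * indet_t) = indet_s ^ Suc m + indet_t ^ Suc m" and
      G: "eval2 G (indet_s + indet_t) (indet_s * indet_t) = indet_s ^ m + indet_t ^ m"
      using less.IH [of "Suc m"] less.IH [of m] 3 by auto
    show ?thesis
      by (rule exI [of _ "indet_s * F - indet_t * G"])
         (simp add: eval2_diff eval2_mult F G 3 algebra_simps)
  qed
qed

lemma eval2_eq_0_imp:
  assumes "\<And>x y :: complex. eval2 D x y = 0"
  shows "D = 0"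
proof -
  have inj: "c = 0" if "\<And>y :: complex. poly (map_poly of_int c) y = 0" for c :: "int poly"
  proof -
    have "map_poly of_int c = (0 :: complex poly)"
      using that poly_all_0_iff_0 by blast
    hence "\<forall>i. (of_int (coeff c i) :: complex) = 0"
      by (metis coeff_0 coeff_map_poly of_int_0)
    thus ?thesis by (simp add: poly_eq_iff)
  qed
  have "coeff D i = 0" for i
  proof (rule inj)
    fix y :: complex
    have "map_poly (\<lambda>c. poly (map_poly of_int c) y) D = 0"
      using assms [of _ y] unfolding eval2_def using poly_all_0_iff_0 by blast
    hence "coeff (map_poly (\<lambda>c. poly (map_poly of_int c) y) D) i = 0"
      by simp
    thus "poly (map_poly of_int (coeff D i)) y = 0"
      by (simp add: coeff_map_poly)
  qed
  thus ?thesis by (simp add: poly_eq_iff)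
qed

lemma Lpoly_unique:
  assumes "eval2 F (indet_s + indet_t) (indet_s * indet_t) =
           eval2 G (indet_s + indet_t) (indet_s * indet_t)"
  shows "F = G"
proof -
  have "eval2 (F - G) x y = 0" for x y :: complex
  proof -
    define r where "r = csqrt (x ^ 2 - 4 * y)"
    define s t where "s = (x + r) / 2" and "t = (x - r) / 2"
    have r: "r ^ 2 = x ^ 2 - 4 * y" by (simp add: r_def)
    have st: "s + t = x" "s * t = y"
      using r by (simp_all add: s_def t_def field_simps power2_eq_square)
    have "eval2 (eval2 (F - G) (indet_s + indet_t) (indet_s * indet_t)) s t = 0"
      using assms by (simp add: eval2_diff)
    thus ?thesis by (simp add: eval2_eval2 eval2_add eval2_mult st)
  qed
  thus ?thesis using eval2_eq_0_imp [of "F - G"] by simp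
qed

lemma eval2_Lpoly:
  "eval2 (Lpoly n) (indet_s + indet_t) (indet_s * indet_t) = indet_s ^ n + indet_t ^ n"
  unfolding Lpoly_def
  by (rule theI') (metis Lpoly_exists Lpoly_unique)

end

theory Submission
  imports Defs
begin

text \<open>
  Write \<open>z = s + t\<close> with \<open>s t = p = a b\<close>. Then \<open>L\<^sub>n(z, p) - q = s\<^sup>n + t\<^sup>n - a\<^sup>n - b\<^sup>n\<close>, because
  \<open>q = a\<^sup>n + b\<^sup>n\<close>. For every \<open>w \<noteq> 0\<close> the relation \<open>s t = a b\<close> gives
  \<open>s (s + t - w a - w\<^sup>-\<^sup>1 b) = (s - w a) (s - w\<^sup>-\<^sup>1 b)\<close>. Multiplying over \<open>w = \<zeta>\<^sup>j\<close> turns the right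
  side into \<open>(s\<^sup>n - a\<^sup>n) (s\<^sup>n - b\<^sup>n) = s\<^sup>n (s\<^sup>n + t\<^sup>n - a\<^sup>n - b\<^sup>n)\<close>
  (lemmas \<open>prod_minus_powers_primitive_root\<close> and \<open>prod_sum_minus_twisted_sum\<close>). Cancelling \<open>s\<^sup>n\<close>, which is possible
  for a suitable choice of \<open>s\<close> as soon as \<open>z \<noteq> 0\<close>, shows that \<open>L\<^sub>n(z, p) - q\<close> and the product of the
  \<open>z - \<zeta>\<^sup>j a - \<zeta>\<^sup>-\<^sup>j b\<close> agree at every \<open>z \<noteq> 0\<close>. Hence they are equal as polynomials
  (lemma \<open>Lpoly_minus_eq_prod\<close>), and this factorization also accounts for the multiplicities.
\<close>

lemma poly_eval2:
  "poly (eval2 F u v) z = eval2 F (poly u z) (poly v (z :: 'a :: comm_ring_1))"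
proof -
  have "poly (poly (map_poly of_int c) v) z = poly (map_poly of_int c) (poly v z)" for c :: "int poly"
    by (induction c) (simp_all add: map_poly_pCons of_int_poly)
  thus ?thesis
    by (induction F) simp_all
qed

lemma eval2_Lpoly_sum_prod:
  fixes s t :: "'a :: comm_ring_1"
  shows "eval2 (Lpoly n) (s + t) (s * t) = s ^ n + t ^ n"
proof -
  have eval2_1: "eval2 1 s t = 1"
    using eval2_const [of 1 s t] by (simp flip: one_pCons)
  have eval2_power: "eval2 (F ^ k) s t = eval2 F s t ^ k" for F k
    by (induction k) (simp_all add: eval2_1 eval2_mult)
  have "eval2 (eval2 (Lpoly n) (indet_s + indet_t) (indet_s * indet_t)) s t = s ^ n + t ^ n"
    by (simp only: eval2_Lpoly) (simp add: eval2_add eval2_power)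
  thus ?thesis
    by (simp add: eval2_eval2 eval2_add eval2_mult)
qed

lemma primitive_root_nonzero: "primitive_root_of_unity n \<zeta> \<Longrightarrow> \<zeta> \<noteq> 0"
  by (auto simp: primitive_root_of_unity_def power_0_left)

lemma primitive_root_inverse:
  "primitive_root_of_unity n \<zeta> \<Longrightarrow> primitive_root_of_unity n (inverse \<zeta>)"
  by (auto simp: primitive_root_of_unity_def power_inverse)

lemma inj_on_powers_primitive_root:
  assumes "primitive_root_of_unity n \<zeta>"
  shows "inj_on (\<lambda>j. \<zeta> ^ j) {0..<n}"
proof (rule linorder_inj_onI)
  fix i j assume ij: "i < j" "i \<in> {0..<n}" "j \<in> {0..<n}"
  show "\<zeta> ^ i \<noteq> \<zeta> ^ j"
  proof
    assume "\<zeta> ^ i = \<zeta> ^ j"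
    hence "\<zeta> ^ i * \<zeta> ^ (j - i) = \<zeta> ^ i"
      using ij by (metis less_imp_le_nat le_add_diff_inverse power_add)
    hence "\<zeta> ^ (j - i) = 1"
      using primitive_root_nonzero [OF assms] by simp
    thus False
      using assms ij by (auto simp: primitive_root_of_unity_def dest: spec [of _ "j - i"])
  qed
qed auto

text \<open>
  Both sides are monic of degree \<open>n\<close> in \<open>s\<close> and, for \<open>a \<noteq> 0\<close>, vanish at the \<open>n\<close> distinct points
  \<open>\<zeta>\<^sup>j a\<close>; their difference has too small a degree for that many roots.
\<close>

lemma prod_minus_powers_primitive_root:
  assumes \<zeta>: "primitive_root_of_unity n \<zeta>"
  shows "(\<Prod>j\<in>{0..<n}. s - \<zeta> ^ j * a) = s ^ n - a ^ n"
proof (cases "a = 0")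
  case True
  have "n \<ge> 1" using \<zeta> by (simp add: primitive_root_of_unity_def)
  thus ?thesis using True by simp
next
  case False
  define P where "P = (\<Prod>j\<in>{0..<n}. [:- (\<zeta> ^ j * a), 1:])"
  define Q where "Q = monom 1 n - [:a ^ n:]"
  have n: "n \<ge> 1" and \<zeta>n: "\<zeta> ^ n = 1"
    using \<zeta> by (simp_all add: primitive_root_of_unity_def)
  let ?A = "(\<lambda>j. \<zeta> ^ j * a) ` {0..<n}"
  have card: "card ?A = n"
    using inj_on_powers_primitive_root [OF \<zeta>] False
    by (subst card_image) (auto simp: inj_on_def)
  have degP: "degree P = n"
    unfolding P_def by (subst degree_prod_eq_sum_degree) auto
  have "lead_coeff P = 1"
    unfolding P_def by (simp add: lead_coeff_prod)
  have degQ: "degree Q \<le> n"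
    unfolding Q_def by (intro degree_diff_le) (auto simp: degree_monom_le)
  have "P = Q"
  proof (rule poly_eqI_degree_lead_coeff [where A = ?A and n = n])
    show "coeff P n = coeff Q n"
      using \<open>lead_coeff P = 1\<close> degP n by (auto simp: Q_def coeff_pCons split: nat.splits)
    show "poly P z = poly Q z" if z: "z \<in> ?A" for z
    proof -
      obtain j where j: "j < n" "z = \<zeta> ^ j * a" using z by auto
      have "z ^ n = (\<zeta> ^ n) ^ j * a ^ n"
        by (simp add: j power_mult_distrib mult.commute flip: power_mult)
      moreover have "poly P z = 0"
        using j by (auto simp: P_def poly_prod)
      ultimately show ?thesis
        by (simp add: Q_def poly_monom \<zeta>n)
    qed
  qed (use card degP degQ in auto)
  hence "poly P s = poly Q s" by simp
  thus ?thesis by (simp add: P_def Q_def poly_prod poly_monom)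
qed

lemma prod_sum_minus_twisted_sum:
  assumes \<zeta>: "primitive_root_of_unity n \<zeta>" and st: "s * t = a * b" and s: "s \<noteq> 0"
  shows "(\<Prod>j\<in>{0..<n}. s + t - (\<zeta> ^ j * a + inverse \<zeta> ^ j * b)) = s ^ n + t ^ n - (a ^ n + b ^ n)"
proof -
  have factor: "s * (s + t - (\<zeta> ^ j * a + inverse \<zeta> ^ j * b)) =
      (s - \<zeta> ^ j * a) * (s - inverse \<zeta> ^ j * b)" for j
  proof -
    have "\<zeta> ^ j * inverse \<zeta> ^ j = 1"
      using primitive_root_nonzero [OF \<zeta>] by (simp flip: power_mult_distrib)
    hence "(\<zeta> ^ j * a) * (inverse \<zeta> ^ j * b) = s * t"
      using st by (metis (no_types) mult.assoc mult.left_commute mult_1)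
    thus ?thesis by (simp add: algebra_simps)
  qed
  have "s ^ n * (\<Prod>j\<in>{0..<n}. s + t - (\<zeta> ^ j * a + inverse \<zeta> ^ j * b)) =
      (\<Prod>j\<in>{0..<n}. s * (s + t - (\<zeta> ^ j * a + inverse \<zeta> ^ j * b)))"
    by (simp add: prod.distrib)
  also have "\<dots> = (s ^ n - a ^ n) * (s ^ n - b ^ n)"
    by (simp only: factor prod.distrib prod_minus_powers_primitive_root [OF \<zeta>]
        prod_minus_powers_primitive_root [OF primitive_root_inverse [OF \<zeta>]])
  also have "\<dots> = s ^ n * (s ^ n + t ^ n - (a ^ n + b ^ n))"
  proof -
    have "s ^ n * t ^ n = a ^ n * b ^ n"
      using st by (simp flip: power_mult_distrib)
    thus ?thesis by (simp add: algebra_simps)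
  qed
  finally show ?thesis using s by simp
qed

text \<open>
  The pointwise comparison leaves out \<open>z = 0\<close>, because there \<open>s = t = 0\<close> may be the only decomposition (when
  \<open>a b = 0\<close>). Multiplying both polynomials by the variable repairs this.
\<close>

lemma Lpoly_minus_eq_prod:
  assumes \<zeta>: "primitive_root_of_unity n \<zeta>"
  shows "eval2 (Lpoly n) [:0, 1:] [:a * b:] - [:a ^ n + b ^ n:] =
         (\<Prod>j\<in>{0..<n}. [:- (\<zeta> ^ j * a + inverse \<zeta> ^ j * b), 1:])" (is "?P = ?Q")
proof -
  have agree: "poly ?P z = poly ?Q z" if "z \<noteq> 0" for z
  proof -
    \<comment> \<open>\<open>s\<close> and \<open>t\<close> are the roots of \<open>x\<^sup>2 - z x + a b\<close>; as \<open>s + t = z \<noteq> 0\<close>, one of them is nonzero.\<close>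
    define w where "w = csqrt (z ^ 2 - 4 * (a * b))"
    have w: "w ^ 2 = z ^ 2 - 4 * (a * b)" by (simp add: w_def)
    obtain s t where st: "s + t = z" "s * t = a * b" "s \<noteq> 0"
    proof (cases "z + w = 0")
      case False
      show ?thesis
        by (rule that [of "(z + w) / 2" "(z - w) / 2"])
           (use w False in \<open>simp_all add: field_simps power2_eq_square\<close>)
    next
      case True
      hence "z - w \<noteq> 0" using \<open>z \<noteq> 0\<close> by auto
      show ?thesis
        by (rule that [of "(z - w) / 2" "(z + w) / 2"])
           (use w \<open>z - w \<noteq> 0\<close> in \<open>simp_all add: field_simps power2_eq_square\<close>)
    qed
    have "poly ?P z = s ^ n + t ^ n - (a ^ n + b ^ n)"
      using eval2_Lpoly_sum_prod [of n s t] by (simp add: poly_eval2 st)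
    also have "\<dots> = poly ?Q z"
      using prod_sum_minus_twisted_sum [OF \<zeta> st(2,3)] by (simp add: poly_prod st algebra_simps)
    finally show ?thesis .
  qed
  have "poly ([:0, 1:] * ?P) = poly ([:0, 1:] * ?Q)"
  proof
    show "poly ([:0, 1:] * ?P) z = poly ([:0, 1:] * ?Q) z" for z
      by (subst (1 2) poly_mult, cases "z = 0") (simp, subst agree, simp, rule refl)
  qed
  hence "[:0, 1:] * ?P = [:0, 1:] * ?Q" by (simp only: poly_eq_poly_eq_iff)
  thus ?thesis by (subst (asm) mult_left_cancel) auto
qed

theorem mainTheorem4:
  fixes n :: nat and \<zeta> p q r a b :: complex
  assumes "n \<ge> 1"
    and "primitive_root_of_unity n \<zeta>"
    and "r ^ 2 = q ^ 2 - 4 * p ^ n"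
    and "a ^ n = (q + r) / 2"
    and "b ^ n = (q - r) / 2"
    and "a * b = p"
  shows "proots (eval2 (Lpoly n) [:0, 1:] [:p:] - [:q:]) =
         image_mset (\<lambda>j. \<zeta> ^ j * a + inverse \<zeta> ^ j * b) (mset_set {0..<n})"
proof -
  have "a ^ n + b ^ n = q"
    unfolding assms(4,5) by (simp flip: add_divide_distrib)
  hence "eval2 (Lpoly n) [:0, 1:] [:p:] - [:q:] =
      (\<Prod>j\<in>{0..<n}. [:- (\<zeta> ^ j * a + inverse \<zeta> ^ j * b), 1:])"
    using Lpoly_minus_eq_prod [OF assms(2), of a b] assms(6) by simp
  moreover have "proots (\<Prod>j\<in>J. [:- (f j :: complex), 1:]) = image_mset f (mset_set J)"
    if "finite J" for f and J :: "nat set"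
  proof -
    have "proots (\<Prod>j\<in>J. [:- f j, 1:]) = (\<Sum>j\<in>J. {#f j#})"
      by (simp add: proots_prod)
    also have "\<dots> = image_mset f (mset_set J)"
      using that by (induction J) simp_all
    finally show ?thesis .
  qed
  ultimately show ?thesis by (simp only: finite_atLeastLessThan)
qed

end
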